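(* Let $c^{m,l}\in\mathcal{C}_{\mathrm{per}}$ ($m=1,\dots,M$, $l=0,\dots,N_t$) be numerical concentrations generated by the semi-implicit scheme (S) described in the context. Then the scheme respects mass conservation, in the sense that the total concentration of each species remains constant in time: for every $m=1,\dots,M$, $$h^3\sum_{i,j,k=1}^{N}c^{m,l+1}_{i,j,k}=h^3\sum_{i,j,k=1}^{N}c^{m,l}_{i,j,k},\qquad l=0,\dots,N_t-1.$$
   Context: Grid and periodic functions. $\Omega=[a,b]^3$, $N$ is a positive integer, $h=(b-a)/N$, and grid points are $x_i=a+(i-\frac12)h$, $y_j=a+(j-\frac12)h$, $z_k=a+(k-\frac12)h$. $\mathcal{C}_{\mathrm{per}}$ is the space of real grid functions $v=(v_{i,j,k})_{i,j,k\in\mathbb{Z}}$ that are $N$-periodic in each index: $v_{i,j,k}=v_{i+\alpha N,j+\beta N,k+\gamma N}$ for all integers $\alpha,\beta,\gamma$. The average of $v$ is $\overline{v}=\frac{h^3}{|\Omega|}\sum_{i,j,k=1}^N v_{i,j,k}$. Face-centered periodic functions in the $x$-direction have values $f_{i+\frac12,j,k}$ and are $N$-periodic in each index; similarly in the $y$- and $z$-directions. Difference operators. $D_xv_{i+\frac12,j,k}=\frac1h(v_{i+1,j,k}-v_{i,j,k})$, $A_xv_{i+\frac12,j,k}=\frac12(v_{i+1,j,k}+v_{i,j,k})$, and for face functions $d_xf_{i,j,k}=\frac1h(f_{i+\frac12,j,k}-f_{i-\frac12,j,k})$; $D_y,D_z,A_y,A_z,d_y,d_z$ are analogous. For $v\in\mathcal{C}_{\mathrm{per}}$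 and a periodic coefficient $\mathcal{D}$ given at the face points, $\nabla_h\cdot(\mathcal{D}\nabla_hv)_{i,j,k}=d_x(\mathcal{D}D_xv)_{i,j,k}+d_y(\mathcal{D}D_yv)_{i,j,k}+d_z(\mathcal{D}D_zv)_{i,j,k}$, and $\Delta_h v=\nabla_h\cdot(\nabla_h v)$ (the case $\mathcal{D}\equiv1$). Parameters. $M\ge1$ is the number of ionic species; $z^m\in\mathbb{R}$ are valences; $\epsilon^m>0$; $\sigma^m>0$ are gradient energy coefficients; $\kappa$ is a periodic coefficient function with $\kappa\ge\kappa_0>0$; $G=(g^{mn})$ is a symmetric $M\times M$ matrix with non-negative entries, and $G=G_c-G_e$ where $G_c=(g_c^{mn})$ and $G_e=(g_e^{mn})$ are positive semi-definite (symmetric) matrices; $\rho_h^f\in\mathcal{C}_{\mathrm{per}}$ is the fixed charge density. The time step is $\Delta t=T/N_t$ with $T>0$ and $N_t$ a positive integer. The initial data $c^{m,0}$ (the grid restriction of the initial concentrations) satisfy the discrete neutrality condition $\overline{\rho_h^f}+\sum_{m=1}^Mz^m\overline{c^{m,0}}=0$. Scheme (S). Given $c^{m,l}\in\mathcal{C}_{\mathrm{per}}$, $m=1,\dots,M$, find positive $c^{m,l+1}\in\mathcal{C}_{\mathrm{per}}$, together with $\mu^{m,l+1},\psi^{l+1}\in\mathcal{C}_{\mathrm{per}}$, such that for $m=1,\dots,M$ $$\frac{c^{m,l+1}-c^{m,l}}{\Delta t}=\epsilon^m\nabla_h\cdot\left(\check c^{m,l}\nabla_h\mu^{m,l+1}\right),$$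 $$\mu^{m,l+1}=z^m\psi^{l+1}+\log c^{m,l+1}+\sum_{n=1}^Mg_c^{mn}c^{n,l+1}-\sigma^m\Delta_hc^{m,l+1}-\sum_{n=1}^Mg_e^{mn}c^{n,l},$$ $$-\nabla_h\cdot(\kappa\nabla_h\psi^{l+1})=\sum_{m=1}^Mz^mc^{m,l+1}+\rho_h^f,$$ where the mobilities at face points are $\check c^{m,l}_{i+\frac12,j,k}=A_xc^{m,l}_{i+\frac12,j,k}$, $\check c^{m,l}_{i,j+\frac12,k}=A_yc^{m,l}_{i,j+\frac12,k}$, $\check c^{m,l}_{i,j,k+\frac12}=A_zc^{m,l}_{i,j,k+\frac12}$. *)

theory Defs
  imports "HOL-Analysis.Analysis"
begin

text \<open>
  A value of type \<open>gridfun\<close> is used both for cell-centred functions and for face-centred ones.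
  The half-integer index of a face-centred function is stored by its integer part: for an
  \<open>x\<close>-face function, \<open>f i j k\<close> is the value at \<open>(i + 1/2, j, k)\<close>; for a \<open>y\<close>-face function it is
  the value at \<open>(i, j + 1/2, k)\<close>; for a \<open>z\<close>-face function it is the value at \<open>(i, j, k + 1/2)\<close>.
\<close>

type_synonym gridfun = "int \<Rightarrow> int \<Rightarrow> int \<Rightarrow> real"

definition C_per :: "nat \<Rightarrow> gridfun set" where
  "C_per N = {v. \<forall>i j k \<alpha> \<beta> \<gamma>.
     v i j k = v (i + \<alpha> * int N) (j + \<beta> * int N) (k + \<gamma> * int N)}"

definition grid_point :: "real \<Rightarrow> real \<Rightarrow> int \<Rightarrow> real" where
  "grid_point a h i = a + (of_int i - 1/2) * h"

definition grid_sum :: "nat \<Rightarrow> gridfun \<Rightarrow> real" where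
  "grid_sum N v = (\<Sum>i=1..int N. \<Sum>j=1..int N. \<Sum>k=1..int N. v i j k)"

text \<open>The factor \<open>(b - a)^3\<close> is the volume of the box \<open>[a,b]^3\<close>.\<close>

definition grid_avg :: "real \<Rightarrow> real \<Rightarrow> nat \<Rightarrow> gridfun \<Rightarrow> real" where
  "grid_avg a b N v = ((b - a) / real N) ^ 3 / (b - a) ^ 3 * grid_sum N v"

definition Dx :: "real \<Rightarrow> gridfun \<Rightarrow> gridfun" where
  "Dx h v i j k = (v (i + 1) j k - v i j k) / h"

definition Dy :: "real \<Rightarrow> gridfun \<Rightarrow> gridfun" where
  "Dy h v i j k = (v i (j + 1) k - v i j k) / h"

definition Dz :: "real \<Rightarrow> gridfun \<Rightarrow> gridfun" where
  "Dz h v i j k = (v i j (k + 1) - v i j k) / h"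

definition Ax :: "gridfun \<Rightarrow> gridfun" where
  "Ax v i j k = (v (i + 1) j k + v i j k) / 2"

definition Ay :: "gridfun \<Rightarrow> gridfun" where
  "Ay v i j k = (v i (j + 1) k + v i j k) / 2"

definition Az :: "gridfun \<Rightarrow> gridfun" where
  "Az v i j k = (v i j (k + 1) + v i j k) / 2"

definition dx :: "real \<Rightarrow> gridfun \<Rightarrow> gridfun" where
  "dx h f i j k = (f i j k - f (i - 1) j k) / h"

definition dy :: "real \<Rightarrow> gridfun \<Rightarrow> gridfun" where
  "dy h f i j k = (f i j k - f i (j - 1) k) / h"

definition dz :: "real \<Rightarrow> gridfun \<Rightarrow> gridfun" where
  "dz h f i j k = (f i j k - f i j (k - 1)) / h"

text \<open>The coefficient is given by its values on the \<open>x\<close>-, \<open>y\<close>- and \<open>z\<close>-faces.\<close>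

definition div_grad :: "real \<Rightarrow> gridfun \<Rightarrow> gridfun \<Rightarrow> gridfun \<Rightarrow> gridfun \<Rightarrow> gridfun" where
  "div_grad h Kx Ky Kz v i j k =
     dx h (\<lambda>i j k. Kx i j k * Dx h v i j k) i j k
   + dy h (\<lambda>i j k. Ky i j k * Dy h v i j k) i j k
   + dz h (\<lambda>i j k. Kz i j k * Dz h v i j k) i j k"

definition laplace_h :: "real \<Rightarrow> gridfun \<Rightarrow> gridfun" where
  "laplace_h h = div_grad h (\<lambda>_ _ _. 1) (\<lambda>_ _ _. 1) (\<lambda>_ _ _. 1)"

definition sym_psd :: "real^'n^'n \<Rightarrow> bool" where
  "sym_psd A \<longleftrightarrow> transpose A = A \<and> (\<forall>v. 0 \<le> v \<bullet> (A *v v))"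

text \<open>
  One step of the semi-implicit scheme, from concentrations \<open>c\<close> to concentrations \<open>c'\<close> with
  chemical potentials \<open>\<mu>\<close> and electric potential \<open>\<psi>\<close> at the new time level. The ionic species
  are the elements of the (nonempty) finite type \<open>'s\<close>, so their number is \<open>CARD('s)\<close>.
\<close>

definition scheme_step ::
  "nat \<Rightarrow> real \<Rightarrow> real \<Rightarrow> ('s::finite \<Rightarrow> real) \<Rightarrow> ('s \<Rightarrow> real) \<Rightarrow> ('s \<Rightarrow> real)
   \<Rightarrow> gridfun \<Rightarrow> gridfun \<Rightarrow> gridfun \<Rightarrow> real^'s^'s \<Rightarrow> real^'s^'s \<Rightarrow> gridfun
   \<Rightarrow> ('s \<Rightarrow> gridfun) \<Rightarrow> ('s \<Rightarrow> gridfun) \<Rightarrow> ('s \<Rightarrow> gridfun) \<Rightarrow> gridfun \<Rightarrow> bool" where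
  "scheme_step N h \<Delta>t z \<epsilon> \<sigma> \<kappa>x \<kappa>y \<kappa>z Gc Ge \<rho> c c' \<mu> \<psi> \<longleftrightarrow>
     (\<forall>m. c' m \<in> C_per N) \<and> (\<forall>m. \<mu> m \<in> C_per N) \<and> \<psi> \<in> C_per N \<and>
     (\<forall>m i j k. c' m i j k > 0) \<and>
     (\<forall>m i j k. (c' m i j k - c m i j k) / \<Delta>t =
        \<epsilon> m * div_grad h (Ax (c m)) (Ay (c m)) (Az (c m)) (\<mu> m) i j k) \<and>
     (\<forall>m i j k. \<mu> m i j k =
        z m * \<psi> i j k + ln (c' m i j k) + (\<Sum>n\<in>UNIV. Gc $ m $ n * c' n i j k)
        - \<sigma> m * laplace_h h (c' m) i j k - (\<Sum>n\<in>UNIV. Ge $ m $ n * c n i j k)) \<and>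
     (\<forall>i j k. - div_grad h \<kappa>x \<kappa>y \<kappa>z \<psi> i j k = (\<Sum>m\<in>UNIV. z m * c' m i j k) + \<rho> i j k)"

end

theory Submission
  imports Defs
begin

text \<open>
  Summing the mass balance over one period kills the right-hand side: each of the three terms of
  the discrete divergence is a backward difference of a periodic flux, so its sum telescopes.
\<close>

lemma C_perD: "v \<in> C_per N \<Longrightarrow>
    v (i + \<alpha> * int N) (j + \<beta> * int N) (k + \<gamma> * int N) = v i j k"
  by (simp add: C_per_def)

text \<open>Shifting the argument commutes with translation by a period. Face averages and
  differences combine a function with its unit shift, so this feeds the periodicity of the
  fluxes.\<close>

lemma C_per_shift:
  assumes "v \<in> C_per N"
  shows "(\<lambda>i j k. v (i + p) (j + q) (k + r)) \<in> C_per N"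
proof -
  have "v (i + p) (j + q) (k + r)
      = v (i + \<alpha> * int N + p) (j + \<beta> * int N + q) (k + \<gamma> * int N + r)"
    for i j k \<alpha> \<beta> \<gamma>
    using C_perD[OF assms, of "i + p" \<alpha> "j + q" \<beta> "k + r" \<gamma>] by (simp add: ac_simps)
  then show ?thesis
    unfolding C_per_def by blast
qed

lemma C_per_comp2:
  assumes "u \<in> C_per N" and "v \<in> C_per N"
  shows "(\<lambda>i j k. F (u i j k) (v i j k)) \<in> C_per N"
  using assms unfolding C_per_def mem_Collect_eq by metis

text \<open>Each flux is a pointwise combination of \<open>c\<close>, \<open>v\<close> and their
  unit shifts, hence inherits their period.\<close>

lemma C_per_flux:
  assumes "c \<in> C_per N" and "v \<in> C_per N"
  shows "(\<lambda>i j k. Ax c i j k * Dx h v i j k) \<in> C_per N"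
    and "(\<lambda>i j k. Ay c i j k * Dy h v i j k) \<in> C_per N"
    and "(\<lambda>i j k. Az c i j k * Dz h v i j k) \<in> C_per N"
proof -
  \<comment> \<open>A general offset treats the three directions at once: they differ only in which
    of \<open>p\<close>, \<open>q\<close>, \<open>r\<close> equals 1.\<close>
  have *: "(\<lambda>i j k. (c (i + p) (j + q) (k + r) + c i j k) / 2
        * ((v (i + p) (j + q) (k + r) - v i j k) / h)) \<in> C_per N" for p q r
    by (intro C_per_comp2[of _ _ _ "(*)"]
        C_per_comp2[OF C_per_shift[OF assms(1)] assms(1), of "\<lambda>s t. (s + t) / 2"]
        C_per_comp2[OF C_per_shift[OF assms(2)] assms(2), of "\<lambda>s t. (s - t) / h"])
  show "(\<lambda>i j k. Ax c i j k * Dx h v i j k) \<in> C_per N"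
    using *[of 1 0 0] by (simp add: Ax_def Dx_def)
  show "(\<lambda>i j k. Ay c i j k * Dy h v i j k) \<in> C_per N"
    using *[of 0 1 0] by (simp add: Ay_def Dy_def)
  show "(\<lambda>i j k. Az c i j k * Dz h v i j k) \<in> C_per N"
    using *[of 0 0 1] by (simp add: Az_def Dz_def)
qed

lemma sum_int_telescope:
  fixes f :: "int \<Rightarrow> 'a::ab_group_add"
  shows "(\<Sum>i=1..int N. f i - f (i - 1)) = f (int N) - f 0"
proof (induction N)
  case (Suc N)
  have "{1..int (Suc N)} = insert (int (Suc N)) {1..int N}" by auto
  then show ?case using Suc by simp
qed simp

text \<open>Moving the sum over \<open>i\<close> innermost allows telescoping in the x-direction at
  fixed \<open>j\<close> and \<open>k\<close>.\<close>

lemma grid_sum_swap: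
  "grid_sum N v = (\<Sum>j=1..int N. \<Sum>k=1..int N. \<Sum>i=1..int N. v i j k)"
  unfolding grid_sum_def by (subst sum.swap, rule sum.cong[OF refl], rule sum.swap)

text \<open>Each line sum telescopes to \<open>(f N j k - f 0 j k) / h\<close>, and the two end
  values are one period apart.\<close>

lemma grid_sum_dx:
  assumes "f \<in> C_per N" shows "grid_sum N (dx h f) = 0"
proof -
  have "(\<Sum>i=1..int N. dx h f i j k) = 0" for j k
    using C_perD[OF assms, of 0 1 j 0 k 0] sum_int_telescope[of "\<lambda>i. f i j k" N]
    by (simp add: dx_def flip: sum_divide_distrib)
  then show ?thesis
    by (simp add: grid_sum_swap)
qed

lemma grid_sum_dy:
  assumes "f \<in> C_per N" shows "grid_sum N (dy h f) = 0"
proof -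
  have "(\<Sum>j=1..int N. dy h f i j k) = 0" for i k
    using C_perD[OF assms, of i 0 0 1 k 0] sum_int_telescope[of "\<lambda>j. f i j k" N]
    by (simp add: dy_def flip: sum_divide_distrib)
  \<comment> \<open>Here \<open>j\<close> is the middle index, so exchanging the two inner sums at
    fixed \<open>i\<close> is enough.\<close>
  then have "(\<Sum>j=1..int N. \<Sum>k=1..int N. dy h f i j k) = 0" for i
    by (subst sum.swap) simp
  then show ?thesis
    by (simp add: grid_sum_def)
qed

lemma grid_sum_dz:
  assumes "f \<in> C_per N" shows "grid_sum N (dz h f) = 0"
proof -
  have "(\<Sum>k=1..int N. dz h f i j k) = 0" for i j
    using C_perD[OF assms, of i 0 j 0 0 1] sum_int_telescope[of "\<lambda>k. f i j k" N]
    by (simp add: dz_def flip: sum_divide_distrib)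
  then show ?thesis
    by (simp add: grid_sum_def)
qed

lemma grid_sum_div_grad:
  assumes "c \<in> C_per N" and "v \<in> C_per N"
  shows "grid_sum N (div_grad h (Ax c) (Ay c) (Az c) v) = 0"
  \<comment> \<open>The two instances of \<open>h\<close> are the mesh widths of the outer
    difference and of the one inside the flux.\<close>
  using grid_sum_dx[OF C_per_flux(1)[OF assms], of h h]
    grid_sum_dy[OF C_per_flux(2)[OF assms], of h h]
    grid_sum_dz[OF C_per_flux(3)[OF assms], of h h]
  by (simp add: grid_sum_def div_grad_def sum.distrib)

text \<open>The mass balance makes the new concentration the old one plus a constant multiple of a
  discrete divergence, whose grid sum vanishes.\<close>

lemma scheme_step_grid_sum:
  assumes step: "scheme_step N h \<Delta>t z \<epsilon> \<sigma> \<kappa>x \<kappa>y \<kappa>z Gc Ge \<rho> c c' \<mu> \<psi>"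
    and "\<Delta>t \<noteq> 0" and "c m \<in> C_per N"
  shows "grid_sum N (c' m) = grid_sum N (c m)"
proof -
  let ?L = "div_grad h (Ax (c m)) (Ay (c m)) (Az (c m)) (\<mu> m)"
  have "\<mu> m \<in> C_per N"
    and "\<And>i j k. (c' m i j k - c m i j k) / \<Delta>t = \<epsilon> m * ?L i j k"
    using step unfolding scheme_step_def by blast+
  then have "c' m i j k = c m i j k + \<Delta>t * \<epsilon> m * ?L i j k" for i j k
    using \<open>\<Delta>t \<noteq> 0\<close> by (simp add: field_simps)
  then have "grid_sum N (c' m) = grid_sum N (c m) + \<Delta>t * \<epsilon> m * grid_sum N ?L"
    by (simp add: grid_sum_def sum.distrib sum_distrib_left)
  then show ?thesis
    using grid_sum_div_grad[OF \<open>c m \<in> C_per N\<close> \<open>\<mu> m \<in> C_per N\<close>] by simp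
qed

theorem theorem4p1:
  fixes a b h T \<Delta>t \<kappa>0 :: real
    and N Nt :: nat
    and z \<epsilon> \<sigma> :: "'s::finite \<Rightarrow> real"
    and \<kappa>x \<kappa>y \<kappa>z \<rho> :: gridfun
    and G Gc Ge :: "real^'s^'s"
    and c_init :: "'s \<Rightarrow> real \<Rightarrow> real \<Rightarrow> real \<Rightarrow> real"
    and c \<mu> :: "'s \<Rightarrow> nat \<Rightarrow> gridfun"
    and \<psi> :: "nat \<Rightarrow> gridfun"
  assumes "a < b" and "N > 0" and "h = (b - a) / real N"
    and "T > 0" and "Nt > 0" and "\<Delta>t = T / real Nt"
    and "\<And>m. \<epsilon> m > 0" and "\<And>m. \<sigma> m > 0"
    and "\<kappa>0 > 0"
    and "\<kappa>x \<in> C_per N" and "\<And>i j k. \<kappa>x i j k \<ge> \<kappa>0"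
    and "\<kappa>y \<in> C_per N" and "\<And>i j k. \<kappa>y i j k \<ge> \<kappa>0"
    and "\<kappa>z \<in> C_per N" and "\<And>i j k. \<kappa>z i j k \<ge> \<kappa>0"
    and "transpose G = G" and "\<And>m n. G $ m $ n \<ge> 0"
    and "G = Gc - Ge" and "sym_psd Gc" and "sym_psd Ge"
    and "\<rho> \<in> C_per N"
    and "\<And>m. c m 0 \<in> C_per N"
    and "\<And>m i j k. i \<in> {1..int N} \<Longrightarrow> j \<in> {1..int N} \<Longrightarrow> k \<in> {1..int N} \<Longrightarrow>
           c m 0 i j k = c_init m (grid_point a h i) (grid_point a h j) (grid_point a h k)"
    and "grid_avg a b N \<rho> + (\<Sum>m\<in>UNIV. z m * grid_avg a b N (c m 0)) = 0"
    and "\<And>l. l < Nt \<Longrightarrow>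
           scheme_step N h \<Delta>t z \<epsilon> \<sigma> \<kappa>x \<kappa>y \<kappa>z Gc Ge \<rho>
             (\<lambda>m. c m l) (\<lambda>m. c m (Suc l)) (\<lambda>m. \<mu> m (Suc l)) (\<psi> (Suc l))"
  shows "\<forall>m. \<forall>l<Nt. h ^ 3 * grid_sum N (c m (Suc l)) = h ^ 3 * grid_sum N (c m l)"
proof (intro allI impI)
  fix m l
  assume "l < Nt"
  \<comment> \<open>A scheme step asserts periodicity of its output only, so for
    \<open>c m l\<close> it comes from the initial data or from the preceding step.\<close>
  have "c m l \<in> C_per N"
  proof (cases l)
    case 0
    then show ?thesis
      using \<open>\<And>m. c m 0 \<in> C_per N\<close> by simp
  next
    case (Suc l')
    then have "l' < Nt"
      using \<open>l < Nt\<close> by simp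
    \<comment> \<open>\<open>assms(25)\<close> is the scheme hypothesis, taken at the step from
      \<open>l'\<close> to \<open>Suc l'\<close>, whose output is \<open>c m l\<close>.\<close>
    from assms(25)[OF this] show ?thesis
      unfolding scheme_step_def Suc by blast
  qed
  moreover have "\<Delta>t \<noteq> 0"
    using \<open>T > 0\<close> \<open>Nt > 0\<close> \<open>\<Delta>t = T / real Nt\<close> by simp
  ultimately show "h ^ 3 * grid_sum N (c m (Suc l)) = h ^ 3 * grid_sum N (c m l)"
    using scheme_step_grid_sum[OF assms(25)[OF \<open>l < Nt\<close>]] by simp
qed

end
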